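(* Let $p,q \in \mathbb{R}[x_1,\ldots,x_d]$ and let $K$ be a closed subset of $\mathbb{R}$. Then the following hold on $K^d$: (i) $\overline{p}$ is symmetric. (ii) $\overline{p+q} = \overline{p}+\overline{q}$. (iii) $\overline{cp} = c\,\overline{p}$, where $c$ is constant. (iv) $\overline{p+c} = \overline{p}+c$, where $c$ is constant. (v) If $p$ is symmetric, then $p=\overline{p}$. (vi) If $p$ is nonnegative, then so is $\overline{p}$. (vii) $T_p(\alpha)=T_{\overline{p}}(\alpha)$ for any sequence $\alpha \in \mathcal{A}$. (viii) If $T_p(\alpha)=T_q(\alpha)$, then $\overline{p}=\overline{q}$ for any sequence $\alpha\in\mathcal{A}$.
   Context: $d$ is a positive integer, $\mathbb{N}_0$ denotes the set of nonnegative integers, $\mathcal{A}$ the set of all real sequences $\alpha=(\alpha_n)_{n\in\mathbb{N}_0}$, and $\mathcal{S}$ the set of all permutations of $\{1,\ldots,d\}$. For a polynomial $p=\sum_{\boldsymbol{i}\in\mathbb{N}_0^d} p_{\boldsymbol{i}}\,x_1^{i_1}\cdots x_d^{i_d}\in\mathbb{R}[x_1,\ldots,x_d]$ (where $\boldsymbol{i}=(i_1,\ldots,i_d)$), the map $T_p:\mathcal{A}\to\mathcal{A}$ is defined by $T_p(\alpha)=(\tilde\alpha_n)_{n\in\mathbb{N}_0}$ with $\tilde\alpha_n=\sum_{\boldsymbol{i}} p_{\boldsymbol{i}}\,\alpha_{n+i_1}\alpha_{n+i_2}\cdots\alpha_{n+i_d}$ for all $n\in\mathbb{N}_0$. A polynomial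 $p\in\mathbb{R}[x_1,\ldots,x_d]$ is called symmetric if $p(x_1,\ldots,x_d)=p(x_{\pi(1)},\ldots,x_{\pi(d)})$ for all $\pi\in\mathcal{S}$. For $p\in\mathbb{R}[x_1,\ldots,x_d]$, the polynomial $\overline{p}\in\mathbb{R}[x_1,\ldots,x_d]$ is defined by $$\overline{p}(x_1,\ldots,x_d)=\frac{1}{d!}\sum_{\pi\in\mathcal{S}}p(x_{\pi(1)},\ldots,x_{\pi(d)}).$$
   Formalization: In (viii) the hypothesis is that T_p(α)=T_q(α) holds for every sequence α in A; for a single α the claim fails (d=1, p=x, q=2x, α=0). *)

theory Defs
  imports "HOL-Analysis.Analysis" "HOL-Library.Poly_Mapping" "HOL-Combinatorics.Permutations"
begin

(* Real polynomials in the variables x_j, j :: 'd, for a finite index type 'd with d = CARD('d):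
   finitely supported families of coefficients, indexed by exponent vectors. Addition and
   multiplication are those of the monoid algebra, i.e. the usual polynomial operations.
   Equality of two elements of this type is equality of polynomials (of all coefficients). *)
type_synonym 'd rpoly = "('d \<Rightarrow>\<^sub>0 nat) \<Rightarrow>\<^sub>0 real"

definition rconst :: "real \<Rightarrow> 'd rpoly" where
  "rconst c = Poly_Mapping.single 0 c"

definition rvar :: "'d \<Rightarrow> 'd rpoly" where
  "rvar j = Poly_Mapping.single (Poly_Mapping.single j 1) 1"

definition rsubst :: "('d::finite \<Rightarrow> 'd rpoly) \<Rightarrow> 'd rpoly \<Rightarrow> 'd rpoly" where
  "rsubst f p = (\<Sum>i\<in>Poly_Mapping.keys p.
     rconst (Poly_Mapping.lookup p i) * (\<Prod>j\<in>UNIV. f j ^ Poly_Mapping.lookup i j))"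

definition reval :: "'d::finite rpoly \<Rightarrow> real ^ 'd \<Rightarrow> real" where
  "reval p x = (\<Sum>i\<in>Poly_Mapping.keys p.
     Poly_Mapping.lookup p i * (\<Prod>j\<in>UNIV. (x $ j) ^ Poly_Mapping.lookup i j))"

(* p(x_{\<pi>(1)}, ..., x_{\<pi>(d)}) as a polynomial *)
definition rpermute :: "('d::finite \<Rightarrow> 'd) \<Rightarrow> 'd rpoly \<Rightarrow> 'd rpoly" where
  "rpermute \<pi> p = rsubst (\<lambda>j. rvar (\<pi> j)) p"

definition symmetric_rpoly :: "'d::finite rpoly \<Rightarrow> bool" where
  "symmetric_rpoly p \<longleftrightarrow> (\<forall>\<pi>. \<pi> permutes UNIV \<longrightarrow> p = rpermute \<pi> p)"

definition symmetrization :: "'d::finite rpoly \<Rightarrow> 'd rpoly" where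
  "symmetrization p =
     rconst (1 / fact CARD('d)) * (\<Sum>\<pi> | \<pi> permutes (UNIV :: 'd set). rpermute \<pi> p)"

(* The product runs over all d variables: a variable with exponent 0 contributes \<alpha> n. *)
definition T_op :: "'d::finite rpoly \<Rightarrow> (nat \<Rightarrow> real) \<Rightarrow> (nat \<Rightarrow> real)" where
  "T_op p \<alpha> = (\<lambda>n. \<Sum>i\<in>Poly_Mapping.keys p.
     Poly_Mapping.lookup p i * (\<Prod>j\<in>UNIV. \<alpha> (n + Poly_Mapping.lookup i j)))"

definition cart_power :: "real set \<Rightarrow> (real ^ 'd::finite) set" where
  "cart_power K = {x. \<forall>j. x $ j \<in> K}"

(* Symmetry of the function induced by p on K^d; weaker than symmetric_rpoly, e.g. for finite K. *)
definition symmetric_rpoly_on :: "real set \<Rightarrow> 'd::finite rpoly \<Rightarrow> bool" where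
  "symmetric_rpoly_on K p \<longleftrightarrow>
     (\<forall>\<pi>. \<pi> permutes UNIV \<longrightarrow> (\<forall>x\<in>cart_power K. reval p x = reval p (\<chi> j. x $ \<pi> j)))"

end

(* A permutation acts on coefficients by reindexing exponent vectors, and both evaluation at a point
   and (for fixed sequence and n) the n-th entry of T_p are linear in the coefficients; (i)-(vii)
   follow from this.  For (viii) put alpha_k = t^((d+1)^k): the monomial with exponents i becomes t
   to the power sum_j (d+1)^(i_j), and by uniqueness of base d+1 digits this exponent determines i
   up to permutation.  Hence a symmetric polynomial annihilated by the resulting one-variable
   substitution has zero coefficients. *)
theory Submission
  imports Defs "HOL-Computational_Algebra.Polynomial"
begin

section \<open>Linear functionals on polynomials\<close>

text \<open>Common form of \<open>reval\<close> at a point and of an entry of \<open>T_op\<close>: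
  with \<open>g i\<close> the value of the monomial \<open>i\<close>, both become linear
  functionals, so linearity and the effect of a permutation are proved once for both.\<close>

definition linear_extension :: "(('d \<Rightarrow>\<^sub>0 nat) \<Rightarrow> real) \<Rightarrow> 'd rpoly \<Rightarrow> real" where
  "linear_extension g p =
     (\<Sum>i\<in>Poly_Mapping.keys p. Poly_Mapping.lookup p i * g i)"

lemma reval_eq_linear_extension:
  "reval p x = linear_extension (\<lambda>i. \<Prod>j\<in>UNIV. (x $ j) ^ Poly_Mapping.lookup i j) p"
  by (simp add: reval_def linear_extension_def)

lemma T_op_eq_linear_extension:
  "T_op p \<alpha> n = linear_extension (\<lambda>i. \<Prod>j\<in>UNIV. \<alpha> (n + Poly_Mapping.lookup i j)) p"
  by (simp add: T_op_def linear_extension_def)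

text \<open>Zero coefficients contribute nothing. A common index set is needed because
  \<open>keys\<close> may shrink by cancellation in a sum or after scaling by 0.\<close>

lemma linear_extension_superset:
  assumes "finite A" "Poly_Mapping.keys p \<subseteq> A"
  shows "linear_extension g p = (\<Sum>i\<in>A. Poly_Mapping.lookup p i * g i)"
  unfolding linear_extension_def
  by (rule sum.mono_neutral_left) (use assms in \<open>auto simp: in_keys_iff\<close>)

lemma linear_extension_add:
  "linear_extension g (p + q) = linear_extension g p + linear_extension g q"
proof -
  let ?A = "Poly_Mapping.keys p \<union> Poly_Mapping.keys q"
  have "linear_extension g (p + q) = (\<Sum>i\<in>?A. Poly_Mapping.lookup (p + q) i * g i)"
    by (rule linear_extension_superset) (simp_all add: Poly_Mapping.keys_add)
  moreover have "linear_extension g p = (\<Sum>i\<in>?A. Poly_Mapping.lookup p i * g i)"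
    by (rule linear_extension_superset) simp_all
  moreover have "linear_extension g q = (\<Sum>i\<in>?A. Poly_Mapping.lookup q i * g i)"
    by (rule linear_extension_superset) simp_all
  ultimately show ?thesis
    by (simp add: lookup_add distrib_right sum.distrib)
qed

lemma linear_extension_zero [simp]: "linear_extension g 0 = 0"
  by (simp add: linear_extension_def)

lemma linear_extension_sum:
  "linear_extension g (sum f A) = (\<Sum>a\<in>A. linear_extension g (f a))"
  by (induction A rule: infinite_finite_induct) (simp_all add: linear_extension_add)

lemma linear_extension_single [simp]:
  "linear_extension g (Poly_Mapping.single i c) = c * g i"
  by (simp add: linear_extension_def)

lemma lookup_rconst_mult [simp]:
  "Poly_Mapping.lookup (rconst c * p) i = c * Poly_Mapping.lookup p i"
  by (simp add: rconst_def map.rep_eq when_def flip: mult_map_scale_conv_mult)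

lemma linear_extension_rconst_mult:
  "linear_extension g (rconst c * p) = c * linear_extension g p"
proof -
  have "linear_extension g (rconst c * p) =
      (\<Sum>i\<in>Poly_Mapping.keys p. Poly_Mapping.lookup (rconst c * p) i * g i)"
    by (rule linear_extension_superset) (auto simp: in_keys_iff)
  then show ?thesis
    by (simp add: linear_extension_def sum_distrib_left mult.assoc)
qed

lemma linear_extension_diff:
  "linear_extension g (p - q) = linear_extension g p - linear_extension g q"
  using linear_extension_add [of g "p - q" q] by simp

section \<open>The action of permutations\<close>

lemma prod_single_one:
  "(\<Prod>j\<in>A. Poly_Mapping.single (f j) (1::real)) = Poly_Mapping.single (\<Sum>j\<in>A. f j) 1"
  for f :: "'a \<Rightarrow> ('d \<Rightarrow>\<^sub>0 nat)"
  by (induction A rule: infinite_finite_induct) (simp_all add: mult_single)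

lemma rvar_power: "rvar j ^ n = Poly_Mapping.single (Poly_Mapping.single j n) 1"
  by (induction n) (simp_all add: rvar_def mult_single flip: single_add)

lemma lookup_map_key_permutes:
  assumes "\<pi> permutes UNIV"
  shows "Poly_Mapping.lookup (Poly_Mapping.map_key \<pi> i) j = Poly_Mapping.lookup i (\<pi> j)"
  by (simp add: map_key.rep_eq [OF permutes_inj [OF assms]])

lemma map_key_inv_eq_iff:
  assumes "\<pi> permutes UNIV"
  shows "Poly_Mapping.map_key (inv \<pi>) i = k \<longleftrightarrow> i = Poly_Mapping.map_key \<pi> k"
proof -
  have "(\<forall>j. Poly_Mapping.lookup i (inv \<pi> j) = Poly_Mapping.lookup k j) \<longleftrightarrow>
      (\<forall>j. Poly_Mapping.lookup i j = Poly_Mapping.lookup k (\<pi> j))"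
    by (metis permutes_inverses [OF assms])
  then show ?thesis
    by (simp add: poly_mapping_eq_iff fun_eq_iff lookup_map_key_permutes assms
        permutes_inv [OF assms])
qed

text \<open>Replacing each variable \<open>j\<close> by \<open>\<pi> j\<close> moves its exponent to
  position \<open>\<pi> j\<close>, so position \<open>k\<close> receives the exponent of
  \<open>inv \<pi> k\<close>; hence the inverse.\<close>

lemma rpermute_eq_sum:
  assumes "\<pi> permutes UNIV"
  shows "rpermute \<pi> p = (\<Sum>i\<in>Poly_Mapping.keys p.
    Poly_Mapping.single (Poly_Mapping.map_key (inv \<pi>) i) (Poly_Mapping.lookup p i))"
proof -
  have "(\<Sum>j\<in>UNIV. Poly_Mapping.single (\<pi> j) (Poly_Mapping.lookup i j)) =
      Poly_Mapping.map_key (inv \<pi>) i" for i :: "'a \<Rightarrow>\<^sub>0 nat"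
  proof (rule poly_mapping_eqI)
    fix k
    have "(\<Sum>j\<in>UNIV. Poly_Mapping.lookup i j when \<pi> j = k) =
        (\<Sum>j\<in>UNIV. Poly_Mapping.lookup i j when j = inv \<pi> k)"
      by (intro sum.cong refl when_cong) (metis permutes_inverses [OF assms])
    then show "Poly_Mapping.lookup
        (\<Sum>j\<in>UNIV. Poly_Mapping.single (\<pi> j) (Poly_Mapping.lookup i j)) k =
        Poly_Mapping.lookup (Poly_Mapping.map_key (inv \<pi>) i) k"
      by (simp add: lookup_sum lookup_single when_def
          lookup_map_key_permutes [OF permutes_inv [OF assms]])
  qed
  then show ?thesis
    by (simp add: rpermute_def rsubst_def rvar_power prod_single_one rconst_def mult_single)
qed

text \<open>By \<open>map_key_inv_eq_iff\<close> at most one monomial of \<open>p\<close> lands on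
  \<open>i\<close>, namely \<open>map_key \<pi> i\<close>; passing to the preimage cancels the
  inverse.\<close>

lemma lookup_rpermute:
  assumes "\<pi> permutes UNIV"
  shows "Poly_Mapping.lookup (rpermute \<pi> p) i =
    Poly_Mapping.lookup p (Poly_Mapping.map_key \<pi> i)"
  by (simp add: rpermute_eq_sum [OF assms] lookup_sum lookup_single map_key_inv_eq_iff [OF assms]
      when_def in_keys_iff)

lemma linear_extension_rpermute:
  assumes "\<pi> permutes UNIV"
  shows "linear_extension g (rpermute \<pi> p) =
    linear_extension (\<lambda>i. g (Poly_Mapping.map_key (inv \<pi>) i)) p"
  by (simp add: rpermute_eq_sum [OF assms] linear_extension_sum)
     (simp add: linear_extension_def)

text \<open>Reindexing the product over the variables moves the permutation from the exponents to
  the coordinates of the point.\<close>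

lemma reval_rpermute:
  assumes "\<pi> permutes UNIV"
  shows "reval (rpermute \<pi> p) x = reval p (\<chi> j. x $ \<pi> j)"
proof -
  have "(\<Prod>j\<in>UNIV. (x $ j) ^ Poly_Mapping.lookup i (inv \<pi> j)) =
      (\<Prod>j\<in>UNIV. (x $ \<pi> j) ^ Poly_Mapping.lookup i j)" for i
    using prod.permute [OF assms, of "\<lambda>j. (x $ j) ^ Poly_Mapping.lookup i (inv \<pi> j)"]
    by (simp add: o_def permutes_inverses [OF assms])
  then show ?thesis
    by (simp add: reval_eq_linear_extension linear_extension_rpermute [OF assms]
        lookup_map_key_permutes [OF permutes_inv [OF assms]])
qed

text \<open>All factors come from the same sequence, so permuting the exponents merely reorders a
  commutative product.\<close>

lemma T_op_rpermute:
  assumes "\<pi> permutes UNIV"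
  shows "T_op (rpermute \<pi> p) \<alpha> n = T_op p \<alpha> n"
proof -
  have "(\<Prod>j\<in>UNIV. \<alpha> (n + Poly_Mapping.lookup i (inv \<pi> j))) =
      (\<Prod>j\<in>UNIV. \<alpha> (n + Poly_Mapping.lookup i j))" for i
    using prod.permute [OF assms, of "\<lambda>j. \<alpha> (n + Poly_Mapping.lookup i (inv \<pi> j))"]
    by (simp add: o_def permutes_inverses [OF assms])
  then show ?thesis
    by (simp add: T_op_eq_linear_extension linear_extension_rpermute [OF assms]
        lookup_map_key_permutes [OF permutes_inv [OF assms]])
qed

section \<open>Symmetrization\<close>

lemma symmetric_rpoly_iff:
  "symmetric_rpoly p \<longleftrightarrow> (\<forall>\<pi>. \<pi> permutes UNIV \<longrightarrow>
    (\<forall>i. Poly_Mapping.lookup p (Poly_Mapping.map_key \<pi> i) = Poly_Mapping.lookup p i))"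
proof -
  have "p = rpermute \<pi> p \<longleftrightarrow>
      (\<forall>i. Poly_Mapping.lookup p (Poly_Mapping.map_key \<pi> i) = Poly_Mapping.lookup p i)"
    if "\<pi> permutes UNIV" for \<pi>
    unfolding poly_mapping_eq_iff fun_eq_iff lookup_rpermute [OF that]
    by (intro iff_allI eq_commute)
  then show ?thesis
    unfolding symmetric_rpoly_def by (intro iff_allI imp_cong refl)
qed

lemma lookup_symmetrization:
  "Poly_Mapping.lookup (symmetrization p) i = 1 / fact CARD('d) *
    (\<Sum>\<pi> | \<pi> permutes UNIV. Poly_Mapping.lookup p (Poly_Mapping.map_key \<pi> i))"
  for p :: "'d::finite rpoly"
  by (simp add: symmetrization_def lookup_sum lookup_rpermute)

lemma linear_extension_symmetrization:
  "linear_extension g (symmetrization p) = 1 / fact CARD('d) *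
    (\<Sum>\<pi> | \<pi> permutes UNIV. linear_extension g (rpermute \<pi> p))"
  for p :: "'d::finite rpoly"
  by (simp add: symmetrization_def linear_extension_rconst_mult linear_extension_sum)

lemma card_permutes_UNIV: "card {\<pi>. \<pi> permutes (UNIV :: 'd::finite set)} = fact CARD('d)"
  by (rule card_permutations) simp_all

text \<open>Left multiplication by \<open>\<sigma>\<close> is a bijection of the symmetric group, so
  it only reorders the average.\<close>

lemma symmetric_symmetrization: "symmetric_rpoly (symmetrization p)"
  unfolding symmetric_rpoly_iff
proof (intro allI impI)
  fix \<sigma> :: "'a \<Rightarrow> 'a" and i
  assume \<sigma>: "\<sigma> permutes UNIV"
  have "(\<Sum>\<pi> | \<pi> permutes UNIV. Poly_Mapping.lookup p (Poly_Mapping.map_key (\<sigma> \<circ> \<pi>) i)) =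
      (\<Sum>\<pi> | \<pi> permutes UNIV. Poly_Mapping.lookup p (Poly_Mapping.map_key \<pi> i))"
  proof (rule sum.reindex_bij_witness [of _ "\<lambda>\<pi>. inv \<sigma> \<circ> \<pi>" "\<lambda>\<pi>. \<sigma> \<circ> \<pi>"])
    fix \<pi> :: "'a \<Rightarrow> 'a"
    show "inv \<sigma> \<circ> (\<sigma> \<circ> \<pi>) = \<pi>" "\<sigma> \<circ> (inv \<sigma> \<circ> \<pi>) = \<pi>"
      by (simp_all add: fun_eq_iff permutes_inverses [OF \<sigma>])
    assume "\<pi> \<in> {\<pi>. \<pi> permutes UNIV}"
    then show "\<sigma> \<circ> \<pi> \<in> {\<pi>. \<pi> permutes UNIV}" "inv \<sigma> \<circ> \<pi> \<in> {\<pi>. \<pi> permutes UNIV}"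
      by (simp_all add: permutes_compose \<sigma> permutes_inv)
  qed simp
  \<comment> \<open>\<open>map_key\<close> is precomposition, hence contravariant: the inner
    \<open>\<sigma>\<close> becomes the outer factor.\<close>
  moreover have "Poly_Mapping.map_key \<pi> (Poly_Mapping.map_key \<sigma> i) =
      Poly_Mapping.map_key (\<sigma> \<circ> \<pi>) i" if "\<pi> permutes UNIV" for \<pi>
    by (rule map_key_compose [OF permutes_inj [OF that] permutes_inj [OF \<sigma>]])
  ultimately show "Poly_Mapping.lookup (symmetrization p) (Poly_Mapping.map_key \<sigma> i) =
      Poly_Mapping.lookup (symmetrization p) i"
    by (simp add: lookup_symmetrization)
qed

lemma symmetrization_add: "symmetrization (p + q) = symmetrization p + symmetrization q"
  by (rule poly_mapping_eqI)
     (simp add: lookup_symmetrization lookup_add sum.distrib add_divide_distrib)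

lemma symmetrization_rconst_mult: "symmetrization (rconst c * p) = rconst c * symmetrization p"
  by (rule poly_mapping_eqI) (simp add: lookup_symmetrization flip: sum_distrib_left)

lemma symmetrization_of_symmetric:
  assumes "symmetric_rpoly p"
  shows "symmetrization p = p"
  using assms
  by (intro poly_mapping_eqI)
     (simp add: lookup_symmetrization symmetric_rpoly_iff card_permutes_UNIV)

text \<open>The exponent vector 0 is fixed by every reindexing. With additivity of the
  symmetrization this yields (iv).\<close>

lemma symmetric_rconst: "symmetric_rpoly (rconst c)"
  by (simp add: symmetric_rpoly_def rpermute_eq_sum rconst_def permutes_inj [of _ UNIV]
      permutes_inv)

lemma symmetric_rpoly_diff:
  "symmetric_rpoly p \<Longrightarrow> symmetric_rpoly q \<Longrightarrow> symmetric_rpoly (p - q)"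
  by (simp add: symmetric_rpoly_iff lookup_minus)

lemma symmetric_rpoly_on_if_symmetric: "symmetric_rpoly p \<Longrightarrow> symmetric_rpoly_on K p"
  unfolding symmetric_rpoly_def symmetric_rpoly_on_def by (metis reval_rpermute)

lemma reval_symmetrization:
  "reval (symmetrization p) x = 1 / fact CARD('d) *
    (\<Sum>\<pi> | \<pi> permutes UNIV. reval p (\<chi> j. x $ \<pi> j))"
  for p :: "'d::finite rpoly"
proof -
  have "reval (symmetrization p) x = 1 / fact CARD('d) *
      (\<Sum>\<pi> | \<pi> permutes UNIV. reval (rpermute \<pi> p) x)"
    unfolding reval_eq_linear_extension by (rule linear_extension_symmetrization)
  then show ?thesis
    by (simp add: reval_rpermute)
qed

lemma T_op_symmetrization: "T_op (symmetrization p) \<alpha> = T_op p \<alpha>"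
proof
  fix n
  show "T_op (symmetrization p) \<alpha> n = T_op p \<alpha> n"
    using T_op_rpermute [of _ p \<alpha> n]
    by (simp add: T_op_eq_linear_extension linear_extension_symmetrization card_permutes_UNIV)
qed

section \<open>Injectivity on symmetric polynomials\<close>

text \<open>Induction on the number of digits: reduction mod \<open>b\<close> isolates the lowest
  digit, and cancelling \<open>b\<close> leaves the shifted digit sequences.\<close>

lemma digits_unique:
  fixes f g :: "nat \<Rightarrow> nat"
  assumes "\<And>k. f k < b" "\<And>k. g k < b"
    and "(\<Sum>k<n. f k * b ^ k) = (\<Sum>k<n. g k * b ^ k)" and "k < n"
  shows "f k = g k"
  using assms
proof (induction n arbitrary: f g k)
  case (Suc n)
  have shift: "(\<Sum>k<Suc n. h k * b ^ k) = h 0 + b * (\<Sum>k<n. h (Suc k) * b ^ k)"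
    for h :: "nat \<Rightarrow> nat"
    unfolding sum.lessThan_Suc_shift by (simp add: sum_distrib_left mult_ac)
  have eq: "f 0 + b * (\<Sum>k<n. f (Suc k) * b ^ k) = g 0 + b * (\<Sum>k<n. g (Suc k) * b ^ k)"
    using Suc.prems(3) by (simp only: shift)
  have zero: "f 0 = g 0"
    using arg_cong [OF eq, of "\<lambda>x. x mod b"] Suc.prems(1,2) by simp
  moreover have "b \<noteq> 0"
    using Suc.prems(1) [of 0] by simp
  ultimately have sums: "(\<Sum>k<n. f (Suc k) * b ^ k) = (\<Sum>k<n. g (Suc k) * b ^ k)"
    using eq by simp
  show ?case
  proof (cases k)
    case 0
    then show ?thesis using zero by simp
  next
    case (Suc l)
    then show ?thesis
      using Suc.IH [of "\<lambda>k. f (Suc k)" "\<lambda>k. g (Suc k)" l] Suc.prems sums by simp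
  qed
qed simp

text \<open>The power of \<open>t\<close> that the monomial \<open>i\<close> becomes at n = 0. At
  most \<open>CARD('d)\<close> variables share an exponent, so in base \<open>Suc CARD('d)\<close>
  these multiplicities are genuine digits.\<close>

definition weight :: "('d::finite \<Rightarrow>\<^sub>0 nat) \<Rightarrow> nat" where
  "weight i = (\<Sum>j\<in>UNIV. Suc CARD('d) ^ Poly_Mapping.lookup i j)"

text \<open>Grouping the variables by their exponent \<open>k\<close> makes the number of such
  variables the digit at place \<open>k\<close>.\<close>

lemma weight_eq_sum_digits:
  fixes i :: "'d::finite \<Rightarrow>\<^sub>0 nat"
  assumes "\<And>j. Poly_Mapping.lookup i j < n"
  shows "weight i = (\<Sum>k<n. card {j. Poly_Mapping.lookup i j = k} * Suc CARD('d) ^ k)"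
proof -
  have "(\<Sum>k<n. \<Sum>j | j \<in> UNIV \<and> Poly_Mapping.lookup i j = k.
      Suc CARD('d) ^ Poly_Mapping.lookup i j) = weight i"
    unfolding weight_def by (rule sum.group) (use assms in auto)
  moreover have "(\<Sum>j | j \<in> UNIV \<and> Poly_Mapping.lookup i j = k.
      Suc CARD('d) ^ Poly_Mapping.lookup i j) =
      card {j. Poly_Mapping.lookup i j = k} * Suc CARD('d) ^ k" for k
    by simp
  ultimately show ?thesis by simp
qed

text \<open>Equal weights have equal digits, so both vectors have the same multiset of exponents and
  differ by a permutation.\<close>

lemma permutes_if_weight_eq:
  fixes i k :: "'d::finite \<Rightarrow>\<^sub>0 nat"
  assumes "weight i = weight k"
  obtains \<pi> where "\<pi> permutes UNIV" "i = Poly_Mapping.map_key \<pi> k"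
proof -
  \<comment> \<open>One more than the largest exponent in either vector, so that both expansions
    have \<open>n\<close> places.\<close>
  define n where
    "n = Suc (Max (range (Poly_Mapping.lookup i) \<union> range (Poly_Mapping.lookup k)))"
  have bound: "Poly_Mapping.lookup i j < n" "Poly_Mapping.lookup k j < n" for j
    by (auto simp: n_def less_Suc_eq_le intro!: Max_ge)
  have card: "card {j. Poly_Mapping.lookup h j = m} < Suc CARD('d)"
    for h :: "'d \<Rightarrow>\<^sub>0 nat" and m
    by (simp add: less_Suc_eq_le card_mono)
  have count: "card {j. Poly_Mapping.lookup i j = m} = card {j. Poly_Mapping.lookup k j = m}" for m
  proof (cases "m < n")
    case True
    show ?thesis
      by (rule digits_unique [OF card card _ True])
         (simp only: assms flip: weight_eq_sum_digits [OF bound(1)] weight_eq_sum_digits [OF bound(2)])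
  next
    case False
    then have "Poly_Mapping.lookup i j \<noteq> m" "Poly_Mapping.lookup k j \<noteq> m" for j
      using bound [of j] by auto
    then show ?thesis by simp
  qed
  have "image_mset (Poly_Mapping.lookup i) (mset_set UNIV) =
      image_mset (Poly_Mapping.lookup k) (mset_set UNIV)"
    using count by (intro multiset_eqI) (simp add: count_image_mset' Collect_conj_eq eq_commute)
  then obtain \<pi> where "\<pi> permutes UNIV"
      "\<And>j. Poly_Mapping.lookup i j = Poly_Mapping.lookup k (\<pi> j)"
    by (auto elim: image_mset_eq_implies_permutes [OF finite])
  then show thesis
    by (intro that) (auto intro!: poly_mapping_eqI simp: lookup_map_key_permutes)
qed

lemma symmetric_rpoly_eq_zero:
  fixes s :: "'d::finite rpoly"
  assumes sym: "symmetric_rpoly s" and T: "\<And>\<alpha>. T_op s \<alpha> 0 = 0"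
  shows "s = 0"
proof (rule poly_mapping_eqI)
  fix i :: "'d \<Rightarrow>\<^sub>0 nat"
  \<comment> \<open>The image of \<open>s\<close> under the substitution of powers of
    \<open>t\<close>; monomials of equal weight are merged.\<close>
  define P where
    "P = (\<Sum>k\<in>Poly_Mapping.keys s. Polynomial.monom (Poly_Mapping.lookup s k) (weight k))"
  have "poly P t = T_op s (\<lambda>n. t ^ (Suc CARD('d) ^ n)) 0" for t
    by (simp add: P_def poly_sum poly_monom T_op_def weight_def power_sum)
  \<comment> \<open>A real polynomial that vanishes at every real \<open>t\<close> is zero.\<close>
  then have "P = 0"
    using T by (simp add: poly_all_0_iff_0 [symmetric])
  then have "0 = Polynomial.coeff P (weight i)"
    by simp
  also have "\<dots> = (\<Sum>k | k \<in> Poly_Mapping.keys s \<and> weight k = weight i. Poly_Mapping.lookup s k)"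
    by (simp add: P_def coeff_sum sum.inter_filter)
  \<comment> \<open>Monomials merged with \<open>i\<close> are permutations of \<open>i\<close>, so
    by symmetry their coefficients agree and cannot cancel.\<close>
  also have "\<dots> = (\<Sum>k | k \<in> Poly_Mapping.keys s \<and> weight k = weight i. Poly_Mapping.lookup s i)"
  proof (rule sum.cong)
    fix k
    assume "k \<in> {k. k \<in> Poly_Mapping.keys s \<and> weight k = weight i}"
    then have "weight k = weight i" by simp
    then obtain \<pi> where "\<pi> permutes UNIV" "k = Poly_Mapping.map_key \<pi> i"
      by (rule permutes_if_weight_eq)
    then show "Poly_Mapping.lookup s k = Poly_Mapping.lookup s i"
      using sym by (simp add: symmetric_rpoly_iff)
  qed simp
  finally have "card {k \<in> Poly_Mapping.keys s. weight k = weight i} = 0 \<or>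
      Poly_Mapping.lookup s i = 0"
    by simp
  \<comment> \<open>If the count is 0, then \<open>i\<close>, which has its own weight, is not a
    key, and its coefficient vanishes as well.\<close>
  then show "Poly_Mapping.lookup s i = Poly_Mapping.lookup 0 i"
    by (auto simp: in_keys_iff)
qed

text \<open>The difference of the symmetrizations is symmetric, and it is annihilated because
  \<open>T_op\<close> is linear in the polynomial and unchanged by symmetrization.\<close>

lemma symmetrization_eq_if_T_op_eq:
  assumes "\<And>\<alpha>. T_op p \<alpha> = T_op q \<alpha>"
  shows "symmetrization p = symmetrization q"
proof -
  have "symmetrization p - symmetrization q = 0"
  proof (rule symmetric_rpoly_eq_zero)
    show "symmetric_rpoly (symmetrization p - symmetrization q)"
      by (intro symmetric_rpoly_diff symmetric_symmetrization)
    fix \<alpha>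
    have "T_op (symmetrization p - symmetrization q) \<alpha> 0 =
        T_op (symmetrization p) \<alpha> 0 - T_op (symmetrization q) \<alpha> 0"
      unfolding T_op_eq_linear_extension by (rule linear_extension_diff)
    then show "T_op (symmetrization p - symmetrization q) \<alpha> 0 = 0"
      by (simp only: T_op_symmetrization assms diff_self)
  qed
  then show ?thesis
    by (rule iffD2 [OF eq_iff_diff_eq_0])
qed

theorem proposition3p2:
  fixes p q :: "'d::finite rpoly" and K :: "real set" and c :: real
  assumes "closed K"
  shows
    "(symmetric_rpoly (symmetrization p) \<and> symmetric_rpoly_on K (symmetrization p)) \<and>

     (symmetrization (p + q) = symmetrization p + symmetrization q \<and>
      (\<forall>x\<in>cart_power K.
        reval (symmetrization (p + q)) x = reval (symmetrization p) x + reval (symmetrization q) x)) \<and>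

     (symmetrization (rconst c * p) = rconst c * symmetrization p \<and>
      (\<forall>x\<in>cart_power K.
        reval (symmetrization (rconst c * p)) x = c * reval (symmetrization p) x)) \<and>

     (symmetrization (p + rconst c) = symmetrization p + rconst c \<and>
      (\<forall>x\<in>cart_power K.
        reval (symmetrization (p + rconst c)) x = reval (symmetrization p) x + c)) \<and>

     ((symmetric_rpoly p \<longrightarrow> p = symmetrization p) \<and>
      (symmetric_rpoly_on K p \<longrightarrow>
        (\<forall>x\<in>cart_power K. reval p x = reval (symmetrization p) x))) \<and>

     ((\<forall>x\<in>cart_power K. 0 \<le> reval p x) \<longrightarrow>
      (\<forall>x\<in>cart_power K. 0 \<le> reval (symmetrization p) x)) \<and>

     (\<forall>\<alpha>. T_op p \<alpha> = T_op (symmetrization p) \<alpha>) \<and>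

     ((\<forall>\<alpha>. T_op p \<alpha> = T_op q \<alpha>) \<longrightarrow>
      symmetrization p = symmetrization q \<and>
      (\<forall>x\<in>cart_power K. reval (symmetrization p) x = reval (symmetrization q) x))"
proof -
  have reval_add: "reval (r + s) x = reval r x + reval s x" for r s :: "'d rpoly" and x
    by (simp add: reval_eq_linear_extension linear_extension_add)
  have reval_mult: "reval (rconst c * r) x = c * reval r x" for r :: "'d rpoly" and x
    by (simp add: reval_eq_linear_extension linear_extension_rconst_mult)
  have reval_const: "reval (rconst c) x = c" for x :: "real ^ 'd"
    by (simp add: reval_eq_linear_extension rconst_def)
  \<comment> \<open>Symmetry on \<open>cart_power K\<close> concerns values only, so the average is
    taken pointwise: all its d! terms equal \<open>reval p x\<close>.\<close>
  have on: "reval p x = reval (symmetrization p) x"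
    if "symmetric_rpoly_on K p" "x \<in> cart_power K" for x
  proof -
    have "reval p (\<chi> j. x $ \<pi> j) = reval p x" if "\<pi> permutes UNIV" for \<pi>
      using \<open>symmetric_rpoly_on K p\<close> \<open>x \<in> cart_power K\<close> that
      by (simp add: symmetric_rpoly_on_def)
    then show ?thesis
      by (simp add: reval_symmetrization card_permutes_UNIV)
  qed
  have nonneg: "0 \<le> reval (symmetrization p) x"
    if "\<forall>x\<in>cart_power K. 0 \<le> reval p x" "x \<in> cart_power K" for x
  proof -
    \<comment> \<open>\<open>cart_power K\<close> is stable under permuting coordinates, so every
      term of the average is a value of \<open>p\<close> on it.\<close>
    have "(\<chi> j. x $ \<pi> j) \<in> cart_power K" for \<pi> :: "'d \<Rightarrow> 'd"
      using that(2) by (simp add: cart_power_def)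
    then show ?thesis
      using that(1) by (auto simp: reval_symmetrization intro!: divide_nonneg_nonneg sum_nonneg)
  qed
  have inject: "symmetrization p = symmetrization q" if "\<forall>\<alpha>. T_op p \<alpha> = T_op q \<alpha>"
    using that by (intro symmetrization_eq_if_T_op_eq) simp
  show ?thesis
    using on nonneg inject
    by (simp add: symmetric_symmetrization symmetric_rpoly_on_if_symmetric symmetrization_add
        symmetrization_rconst_mult symmetrization_of_symmetric symmetric_rconst
        reval_add reval_mult reval_const T_op_symmetrization)
qed

end
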